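(* Let $\mathbb{J}$ be an invertible antisymmetric real $2k\times 2k$ matrix and $d\ge1$. Let $\operatorname{Sp}(\mathbb{R}^{2k},\mathbb{J})$ act on $\widetilde{\mathfrak{h}}^*(\mathbb{R}^{2k},\mathbb{J};\mathbb{R}^d)$ by $g\cdot(\mathcal{K},\mathcal{M})=(\mathcal{K}g^{-1},\mathcal{M})$, and endow $\widetilde{\mathfrak{h}}^*(\mathbb{R}^{2k},\mathbb{J};\mathbb{R}^d)$ with the (minus) Lie--Poisson bracket $\{f,g\}_-$. Then the map $$\mathbf{J}_{\widetilde{\mathfrak{h}}^*}:\widetilde{\mathfrak{h}}^*(\mathbb{R}^{2k},\mathbb{J};\mathbb{R}^d)\to\mathfrak{sp}^*(\mathbb{R}^{2k},\mathbb{J}),\qquad (\mathcal{K},\mathcal{M})\mapsto-\tfrac12\,\mathbb{J}^{-1}\mathcal{K}^T\mathcal{M}^{-1}\mathcal{K}$$ is an equivariant momentum map for this action.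
   Context: $\mathcal{M}_{d\times 2k}$ is the space of real $d\times 2k$ matrices. $\operatorname{Sp}(\mathbb{R}^{2k},\mathbb{J})=\{g:g^T\mathbb{J}g=\mathbb{J}\}$, with Lie algebra $\mathfrak{sp}(\mathbb{R}^{2k},\mathbb{J})=\{\mathcal{S}:\mathbb{J}\mathcal{S}+\mathcal{S}^T\mathbb{J}=0\}$, whose dual is identified with itself by $\langle\mathcal{X},\mathcal{S}\rangle=\operatorname{Tr}(\mathcal{X}\mathcal{S})$; the coadjoint action is then $\operatorname{Ad}^*_{g^{-1}}\mathcal{X}=g\mathcal{X}g^{-1}$. The generalized Heisenberg Lie algebra is $\mathfrak{h}(\mathbb{R}^{2k},\mathbb{J};\mathbb{R}^d)=\mathcal{M}_{2k\times d}\times\operatorname{Sym}(\mathbb{R}^d)$ with bracket $[(\mathcal{A},\mathcal{B}),(\mathcal{A}',\mathcal{B}')]=(0,(\mathcal{A}^T\mathbb{J}\mathcal{A}')^{\rm sym})$, where $M^{\rm sym}=\frac12(M+M^T)$; its dual is identified with $\mathcal{M}_{d\times2k}\times\operatorname{Sym}(\mathbb{R}^d)\ni(\mathcal{K},\mathcal{M})$ by the pairing $\operatorname{Tr}(\mathcal{K}\mathcal{A})+\operatorname{Tr}(\mathcal{M}\mathcal{B})$. $\widetilde{\mathfrak{h}}^*(\mathbb{R}^{2k},\mathbb{J};\mathbb{R}^d)$ is the open subset where $\det\mathcal{M}\neq0$. The minus Lie--Poisson bracket is $\{f,g\}_-(\mathcal{K},\mathcal{M})=-\operatorname{Tr}\big(\mathcal{M}(\partial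 f/\partial\mathcal{K})^T\mathbb{J}\,\partial g/\partial\mathcal{K}\big)$, where $\partial f/\partial\mathcal{K}\in\mathcal{M}_{2k\times d}$ is defined by $\mathbf{d}f\cdot(\delta\mathcal{K},0)=\operatorname{Tr}\big(\frac{\partial f}{\partial\mathcal{K}}\delta\mathcal{K}\big)$. For a Lie group $G$ acting on a Poisson manifold $P$ on the left, with infinitesimal generators $\xi_P$, a map $\mathbf{J}:P\to\mathfrak{g}^*$ is a momentum map if $\{f,\langle\mathbf{J},\xi\rangle\}=\mathbf{d}f\cdot\xi_P$ for all $\xi\in\mathfrak{g}$ and smooth $f$; it is equivariant if $\mathbf{J}(g\cdot p)=\operatorname{Ad}^*_{g^{-1}}\mathbf{J}(p)$. *)

theory Defs
  imports "HOL-Analysis.Analysis"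
begin

section \<open>The Euclidean space of symmetric matrices\<close>

typedef 'd symmat = "{M :: real^'d^'d. transpose M = M}"
  morphisms mat_of Symmat
  by (rule exI[of _ 0]) (simp add: transpose_def vec_eq_iff)

setup_lifting type_definition_symmat

lemma transpose_mat_of [simp]: "transpose (mat_of M) = mat_of M"
  using mat_of by auto

instantiation symmat :: (finite) real_vector
begin
lift_definition zero_symmat :: "'a symmat" is 0
  by (simp add: transpose_def vec_eq_iff)
lift_definition plus_symmat :: "'a symmat \<Rightarrow> 'a symmat \<Rightarrow> 'a symmat" is "(+)"
  by (simp add: transpose_def vec_eq_iff)
lift_definition minus_symmat :: "'a symmat \<Rightarrow> 'a symmat \<Rightarrow> 'a symmat" is "(-)"
  by (simp add: transpose_def vec_eq_iff)
lift_definition uminus_symmat :: "'a symmat \<Rightarrow> 'a symmat" is uminus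
  by (simp add: transpose_def vec_eq_iff)
lift_definition scaleR_symmat :: "real \<Rightarrow> 'a symmat \<Rightarrow> 'a symmat" is "(*\<^sub>R)"
  by (simp add: transpose_def vec_eq_iff)
instance
  by standard (transfer, simp add: algebra_simps)+
end

instantiation symmat :: (finite) real_inner
begin
lift_definition inner_symmat :: "'a symmat \<Rightarrow> 'a symmat \<Rightarrow> real" is inner .
lift_definition norm_symmat :: "'a symmat \<Rightarrow> real" is norm .
definition dist_symmat :: "'a symmat \<Rightarrow> 'a symmat \<Rightarrow> real"
  where "dist_symmat A B = norm (A - B)"
definition sgn_symmat :: "'a symmat \<Rightarrow> 'a symmat"
  where "sgn_symmat A = A /\<^sub>R norm A"
definition uniformity_symmat :: "('a symmat \<times> 'a symmat) filter"
  where "uniformity_symmat = (INF e\<in>{0 <..}. principal {(x, y). dist x y < e})"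
definition open_symmat :: "'a symmat set \<Rightarrow> bool"
  where "open_symmat S = (\<forall>x\<in>S. \<forall>\<^sub>F (x', y) in uniformity. x' = x \<longrightarrow> y \<in> S)"
instance
proof
  fix x y z :: "'a symmat" and r :: real
  show "inner x y = inner y x" by transfer (rule inner_commute)
  show "inner (x + y) z = inner x z + inner y z" by transfer (rule inner_add_left)
  show "inner (r *\<^sub>R x) y = r * inner x y" by transfer simp
  show "0 \<le> inner x x" by transfer simp
  show "(inner x x = 0) = (x = 0)" by transfer simp
  show "norm x = sqrt (inner x x)" by transfer (rule norm_eq_sqrt_inner)
qed (simp_all add: dist_symmat_def sgn_symmat_def uniformity_symmat_def open_symmat_def)
end

lemma bounded_linear_mat_of: "bounded_linear mat_of"
proof
  show "\<exists>K. \<forall>x. norm (mat_of x :: real^'a^'a) \<le> norm x * K"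
    by (rule exI[of _ 1]) (simp add: norm_symmat.rep_eq)
qed (simp_all add: plus_symmat.rep_eq scaleR_symmat.rep_eq)

definition symmat_onb :: "'a::finite symmat set \<Rightarrow> bool" where
  "symmat_onb B \<longleftrightarrow> B \<noteq> {} \<and> finite B \<and>
     (\<forall>u\<in>B. \<forall>v\<in>B. inner u v = (if u = v then 1 else 0)) \<and>
     (\<forall>x. (\<forall>u\<in>B. inner x u = 0) \<longleftrightarrow> x = 0)"

lemma symmat_onb_exists: "\<exists>B :: 'a::finite symmat set. symmat_onb B"
proof -
  let ?S = "{M :: real^'a^'a. transpose M = M}"
  have "subspace ?S"
    by (auto simp: subspace_def transpose_def vec_eq_iff)
  then obtain C where C: "C \<subseteq> ?S" "pairwise orthogonal C" "\<And>x. x \<in> C \<Longrightarrow> norm x = 1"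
    "independent C" "span C = ?S"
    by (rule orthonormal_basis_subspace) (rule that)
  define B where "B = Symmat ` C"
  have rep: "mat_of (Symmat c) = c" if "c \<in> C" for c
    using that C(1) Symmat_inverse by blast
  have ip: "inner u v = (if u = v then 1 else 0)" if "u \<in> B" "v \<in> B" for u v
  proof -
    from that obtain c d where cd: "c \<in> C" "d \<in> C" "u = Symmat c" "v = Symmat d"
      by (auto simp: B_def)
    have "inner c d = (if c = d then 1 else 0)"
      using C(2,3) cd(1,2) by (auto simp: pairwise_def orthogonal_def norm_eq_1)
    moreover have "u = v \<longleftrightarrow> c = d"
      using cd rep by metis
    ultimately show ?thesis
      using cd rep by (simp add: inner_symmat.rep_eq)
  qed
  have zero: "x = 0" if "\<forall>u\<in>B. inner x u = 0" for x
  proof -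
    have "orthogonal (mat_of x) c" if c: "c \<in> C" for c
      using \<open>\<forall>u\<in>B. inner x u = 0\<close> c rep[OF c]
      by (auto simp: B_def inner_symmat.rep_eq orthogonal_def)
    moreover have "mat_of x \<in> span C"
      using C(5) mat_of[of x] by simp
    ultimately have "orthogonal (mat_of x) (mat_of x)"
      by (metis orthogonal_to_span)
    then have "mat_of x = mat_of 0"
      by (simp add: zero_symmat.rep_eq orthogonal_def)
    then show ?thesis by (simp add: mat_of_inject)
  qed
  have "B \<noteq> {}"
  proof
    assume "B = {}"
    then have "Symmat (mat 1 :: real^'a^'a) = 0" using zero by blast
    moreover have "mat_of (Symmat (mat 1 :: real^'a^'a)) = mat 1"
      by (rule Symmat_inverse) simp
    ultimately have "(mat 1 :: real^'a^'a) = 0"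
      by (simp add: zero_symmat.rep_eq)
    then have "(mat 1 :: real^'a^'a) $ undefined $ undefined = 0" by simp
    then show False by (simp add: mat_def)
  qed
  moreover have "finite B"
    using C(4) by (simp add: B_def independent_imp_finite)
  moreover have "\<forall>x. (\<forall>u\<in>B. inner x u = 0) \<longleftrightarrow> x = 0"
    using zero by auto
  ultimately have "symmat_onb B"
    using ip by (simp add: symmat_onb_def)
  then show ?thesis ..
qed

instantiation symmat :: (finite) euclidean_space
begin
definition Basis_symmat :: "'a symmat set" where
  "Basis_symmat = (SOME B. symmat_onb B)"
instance
proof
  have onb: "symmat_onb (Basis :: 'a symmat set)"
    unfolding Basis_symmat_def by (rule someI_ex[OF symmat_onb_exists])
  show "(Basis :: 'a symmat set) \<noteq> {}" "finite (Basis :: 'a symmat set)"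
    using onb by (simp_all add: symmat_onb_def)
  show "inner u v = (if u = v then 1 else 0)" if "u \<in> Basis" "v \<in> Basis" for u v :: "'a symmat"
    using onb that by (simp add: symmat_onb_def)
  show "(\<forall>u\<in>Basis. inner x u = 0) \<longleftrightarrow> x = 0" for x :: "'a symmat"
    using onb unfolding symmat_onb_def by blast
qed
end


section \<open>Smooth functions on open sets\<close>

text \<open>On an open subset of a finite-dimensional space, being of class \<open>C\<^sup>n\<^sup>+\<^sup>1\<close> is the same as being
  differentiable with all directional derivatives of class \<open>C\<^sup>n\<close>.\<close>

primrec Ck_on :: "nat \<Rightarrow> 'p::euclidean_space set \<Rightarrow> ('p \<Rightarrow> real) \<Rightarrow> bool" where
  "Ck_on 0 P f \<longleftrightarrow> continuous_on P f"
| "Ck_on (Suc n) P f \<longleftrightarrow>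
     (\<forall>p\<in>P. f differentiable (at p)) \<and> (\<forall>v. Ck_on n P (\<lambda>p. frechet_derivative f (at p) v))"

definition smooth_on :: "'p::euclidean_space set \<Rightarrow> ('p \<Rightarrow> real) \<Rightarrow> bool" where
  "smooth_on P f \<longleftrightarrow> (\<forall>n. Ck_on n P f)"


section \<open>Matrix Lie groups, actions and momentum maps\<close>

text \<open>The generic \<^const>\<open>exp\<close> is not available here: the type class multiplication on
  vectors is componentwise.\<close>

definition mat_exp :: "real^'n^'n \<Rightarrow> real^'n^'n" where
  "mat_exp A = (\<Sum>i. ((**) A ^^ i) (mat 1) /\<^sub>R fact i)"

definition left_action :: "(real^'n^'n) set \<Rightarrow> (real^'n^'n \<Rightarrow> 'p \<Rightarrow> 'p) \<Rightarrow> 'p set \<Rightarrow> bool" where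
  "left_action G act P \<longleftrightarrow>
     (\<forall>g\<in>G. \<forall>p\<in>P. act g p \<in> P) \<and> (\<forall>p\<in>P. act (mat 1) p = p) \<and>
     (\<forall>g\<in>G. \<forall>h\<in>G. \<forall>p\<in>P. act (g ** h) p = act g (act h p))"

definition inf_generator ::
    "(real^'n^'n \<Rightarrow> 'p::real_normed_vector \<Rightarrow> 'p) \<Rightarrow> real^'n^'n \<Rightarrow> 'p \<Rightarrow> 'p" where
  "inf_generator act \<xi> p = vector_derivative (\<lambda>t. act (mat_exp (t *\<^sub>R \<xi>)) p) (at 0)"

text \<open>In what follows the dual of a matrix Lie algebra is identified with the Lie algebra itself
  by the trace pairing; thus momentum maps take values in the Lie algebra, and the coadjoint action
  \<open>Ad\<^sup>*\<close> of the inverse of \<open>g\<close> becomes conjugation by \<open>g\<close>.\<close>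

definition trace_pairing :: "real^'n^'n \<Rightarrow> real^'n^'n \<Rightarrow> real" where
  "trace_pairing X S = trace (X ** S)"

definition coadjoint :: "real^'n^'n \<Rightarrow> real^'n^'n \<Rightarrow> real^'n^'n" where
  "coadjoint g X = g ** X ** matrix_inv g"

text \<open>The components of a momentum map have to be smooth for their brackets with smooth functions
  to make sense.\<close>

definition momentum_map ::
    "'p::euclidean_space set \<Rightarrow> (('p \<Rightarrow> real) \<Rightarrow> ('p \<Rightarrow> real) \<Rightarrow> 'p \<Rightarrow> real) \<Rightarrow>
     (real^'n^'n) set \<Rightarrow> (real^'n^'n \<Rightarrow> 'p \<Rightarrow> 'p) \<Rightarrow> ('p \<Rightarrow> real^'n^'n) \<Rightarrow> bool" where
  "momentum_map P bracket \<gg> act \<mu> \<longleftrightarrow>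
     (\<forall>p\<in>P. \<mu> p \<in> \<gg>) \<and>
     (\<forall>\<xi>\<in>\<gg>. smooth_on P (\<lambda>p. trace_pairing (\<mu> p) \<xi>)) \<and>
     (\<forall>\<xi>\<in>\<gg>. \<forall>f. smooth_on P f \<longrightarrow> (\<forall>p\<in>P.
        bracket f (\<lambda>q. trace_pairing (\<mu> q) \<xi>) p
          = frechet_derivative f (at p) (inf_generator act \<xi> p)))"

definition equivariant ::
    "'p set \<Rightarrow> (real^'n^'n) set \<Rightarrow> (real^'n^'n \<Rightarrow> 'p \<Rightarrow> 'p) \<Rightarrow> ('p \<Rightarrow> real^'n^'n) \<Rightarrow> bool" where
  "equivariant P G act \<mu> \<longleftrightarrow> (\<forall>g\<in>G. \<forall>p\<in>P. \<mu> (act g p) = coadjoint g (\<mu> p))"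

definition Sp :: "real^'n^'n \<Rightarrow> (real^'n^'n) set" where
  "Sp J = {g. transpose g ** J ** g = J}"

definition sp :: "real^'n^'n \<Rightarrow> (real^'n^'n) set" where
  "sp J = {S. J ** S + transpose S ** J = 0}"


section \<open>The dual of the generalized Heisenberg algebra\<close>

text \<open>The type \<^typ>\<open>'n\<close> stands for \<open>{1..2k}\<close> and \<^typ>\<open>'d\<close> for \<open>{1..d}\<close>, so that \<open>d \<times> 2k\<close> matrices
  have type \<^typ>\<open>real^'n^'d\<close>.\<close>

type_synonym ('n, 'd) heis_dual = "(real^'n^'d) \<times> 'd symmat"

definition heis_dual_reg :: "('n::finite, 'd::finite) heis_dual set" where
  "heis_dual_reg = {(K, M). det (mat_of M) \<noteq> 0}"

definition partial_K ::
    "(('n::finite, 'd::finite) heis_dual \<Rightarrow> real) \<Rightarrow> ('n, 'd) heis_dual \<Rightarrow> real^'d^'n" where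
  "partial_K f p = (THE D. \<forall>\<delta>K. frechet_derivative f (at p) (\<delta>K, 0) = trace (D ** \<delta>K))"

definition lie_poisson ::
    "real^'n^'n \<Rightarrow> (('n::finite, 'd::finite) heis_dual \<Rightarrow> real) \<Rightarrow> (('n, 'd) heis_dual \<Rightarrow> real) \<Rightarrow>
     ('n, 'd) heis_dual \<Rightarrow> real" where
  "lie_poisson J f g = (\<lambda>(K, M).
     - trace (mat_of M ** transpose (partial_K f (K, M)) ** J ** partial_K g (K, M)))"

definition Sp_act :: "real^'n^'n \<Rightarrow> ('n::finite, 'd::finite) heis_dual \<Rightarrow> ('n, 'd) heis_dual" where
  "Sp_act g = (\<lambda>(K, M). (K ** matrix_inv g, M))"

definition J_heis :: "real^'n^'n \<Rightarrow> ('n::finite, 'd::finite) heis_dual \<Rightarrow> real^'n^'n" where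
  "J_heis J = (\<lambda>(K, M).
     - (1/2) *\<^sub>R (matrix_inv J ** transpose K ** matrix_inv (mat_of M) ** K))"

lemma open_heis_dual_reg: "open (heis_dual_reg :: ('n::finite, 'd::finite) heis_dual set)"
proof -
  have "continuous_on UNIV (\<lambda>p :: ('n, 'd) heis_dual. mat_of (snd p) $ i $ j)" for i j
    by (intro continuous_intros bounded_linear.continuous_on[OF bounded_linear_mat_of])
  then have "continuous_on UNIV (\<lambda>p :: ('n, 'd) heis_dual. det (mat_of (snd p)))"
    unfolding det_def by (intro continuous_on_sum continuous_on_mult continuous_on_const continuous_on_prod)
  then have "open ((\<lambda>p :: ('n, 'd) heis_dual. det (mat_of (snd p))) -` (- {0}))"
    by (intro open_vimage open_Compl closed_singleton)
  also have "\<dots> = heis_dual_reg"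
    by (auto simp: heis_dual_reg_def)
  finally show ?thesis .
qed

lemma invertible_Sp:
  assumes "invertible J" "g \<in> Sp J" shows "invertible g"
proof -
  have "det (transpose g ** J ** g) = det J"
    using assms(2) by (simp add: Sp_def)
  then have "det g \<noteq> 0"
    using assms(1) by (auto simp: det_mul invertible_det_nz)
  then show ?thesis by (simp add: invertible_det_nz)
qed

lemma left_action_Sp_act:
  assumes "invertible J"
  shows "left_action (Sp J) Sp_act (heis_dual_reg :: ('n::finite, 'd::finite) heis_dual set)"
proof -
  have inv: "matrix_inv A ** A = mat 1" "A ** matrix_inv A = mat 1" if "invertible A" for A :: "real^'n^'n"
    using that unfolding invertible_def matrix_inv_def by (metis (mono_tags, lifting) someI_ex)+
  have uniq: "B = matrix_inv A" if "A ** B = mat 1" "invertible A" for A B :: "real^'n^'n"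
    using that inv[OF that(2)] by (metis matrix_mul_assoc matrix_mul_lid matrix_mul_rid)
  have "invertible (mat 1 :: real^'n^'n)"
    unfolding invertible_def using matrix_mul_lid by blast
  then have 1: "matrix_inv (mat 1 :: real^'n^'n) = mat 1"
    using uniq[of "mat 1" "mat 1"] by simp
  have "matrix_inv (g ** h) = matrix_inv h ** matrix_inv g"
    if "g \<in> Sp J" "h \<in> Sp J" for g h
  proof (rule uniq[symmetric])
    have ih: "invertible g" "invertible h" using that assms invertible_Sp by blast+
    then show "invertible (g ** h)" by (rule invertible_mult)
    have "g ** h ** (matrix_inv h ** matrix_inv g) = g ** (h ** matrix_inv h) ** matrix_inv g"
      by (simp add: matrix_mul_assoc)
    then show "g ** h ** (matrix_inv h ** matrix_inv g) = mat 1"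
      using ih inv by simp
  qed
  with 1 show ?thesis
    by (auto simp: left_action_def Sp_act_def heis_dual_reg_def matrix_mul_assoc)
qed

end

theory Submission
  imports Defs
begin

text \<open>
  For \<open>\<xi>\<close> in the symplectic Lie algebra, \<open>\<xi> J\<inverse> = - J\<inverse> \<xi>\<^sup>T\<close>. Hence the two terms in the \<open>K\<close>-derivative of
  the quadratic function \<open>-\<onehalf> Tr (J\<inverse> K\<^sup>T M\<inverse> K \<xi>)\<close> coincide, so that its gradient is
  \<open>- \<xi> J\<inverse> K\<^sup>T M\<inverse>\<close>. Inserted into the bracket, \<open>M\<close> cancels and \<open>Tr (D (- K \<xi>))\<close> remains, where \<open>D\<close> is
  the \<open>K\<close>-gradient of \<open>f\<close> and \<open>(- K \<xi>, 0)\<close> the infinitesimal generator at \<open>(K, M)\<close>. Equivariance is the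
  identity \<open>g J\<inverse> = J\<inverse> g\<^sup>-\<^sup>T\<close> for symplectic \<open>g\<close>.
\<close>

section \<open>Calculus of smooth functions\<close>

lemma Ck_on_cong:
  assumes "open P" "Ck_on n P f" "\<And>p. p \<in> P \<Longrightarrow> f p = g p"
  shows "Ck_on n P g"
  using assms(2,3)
proof (induction n arbitrary: f g)
  case 0
  then show ?case using continuous_on_cong[of P P f g] by simp
next
  case (Suc n)
  have "g differentiable at p" if "p \<in> P" for p
    using Suc.prems that assms(1)
    by (metis Ck_on.simps(2) differentiable_def has_derivative_transform_within_open)
  moreover have "Ck_on n P (\<lambda>p. frechet_derivative g (at p) v)" for v
  proof (rule Suc.IH)
    show "Ck_on n P (\<lambda>p. frechet_derivative f (at p) v)" using Suc.prems by simp
    show "frechet_derivative f (at p) v = frechet_derivative g (at p) v" if "p \<in> P" for p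
      using frechet_derivative_transform_within_open[of f p P g] Suc.prems that assms(1) by simp
  qed
  ultimately show ?case by simp
qed

lemma Ck_on_SucI:
  assumes "open P" "\<And>p. p \<in> P \<Longrightarrow> (f has_derivative f' p) (at p)" "\<And>v. Ck_on n P (\<lambda>p. f' p v)"
  shows "Ck_on (Suc n) P f"
proof -
  have "f' p = frechet_derivative f (at p)" if "p \<in> P" for p
    using assms(2)[OF that] by (rule frechet_derivative_at)
  then have "Ck_on n P (\<lambda>p. frechet_derivative f (at p) v)" for v
    using Ck_on_cong[OF assms(1,3)] by simp
  then show ?thesis
    using assms(2) by (auto simp: differentiable_def)
qed

lemma Ck_on_SucD:
  assumes "Ck_on (Suc n) P f"
  shows "Ck_on n P f"
  using assms
proof (induction n arbitrary: f)
  case 0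
  then show ?case
    by (auto intro!: differentiable_imp_continuous_on simp: differentiable_on_def differentiable_at_withinI)
qed auto

lemma Ck_on_has_derivative:
  assumes "Ck_on (Suc n) P f" "p \<in> P"
  shows "(f has_derivative frechet_derivative f (at p)) (at p)"
  using assms by (simp add: frechet_derivative_works)

lemma Ck_on_const: "open P \<Longrightarrow> Ck_on n P (\<lambda>_. c)"
  by (induction n arbitrary: c) simp_all

lemma Ck_on_bounded_linear:
  assumes "open P" "bounded_linear f"
  shows "Ck_on n P f"
proof (cases n)
  case 0
  then show ?thesis using assms by (simp add: linear_continuous_on)
next
  case (Suc m)
  show ?thesis unfolding Suc
    by (rule Ck_on_SucI[OF assms(1) bounded_linear_imp_has_derivative[OF assms(2)]])
      (rule Ck_on_const[OF assms(1)])
qed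

lemma Ck_on_add:
  assumes "open P" "Ck_on n P f" "Ck_on n P g"
  shows "Ck_on n P (\<lambda>p. f p + g p)"
  using assms(2,3)
proof (induction n arbitrary: f g)
  case 0
  then show ?case by (simp add: continuous_on_add)
next
  case (Suc n)
  show ?case
    by (rule Ck_on_SucI[OF assms(1)
          has_derivative_add[OF Ck_on_has_derivative[OF Suc.prems(1)] Ck_on_has_derivative[OF Suc.prems(2)]]])
      (use Suc in simp_all)
qed

lemma Ck_on_mult:
  assumes "open P" "Ck_on n P f" "Ck_on n P g"
  shows "Ck_on n P (\<lambda>p. f p * g p)"
  using assms(2,3)
proof (induction n arbitrary: f g)
  case 0
  then show ?case by (simp add: continuous_on_mult)
next
  case (Suc n)
  show ?case
  proof (rule Ck_on_SucI[OF assms(1)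
          has_derivative_mult[OF Ck_on_has_derivative[OF Suc.prems(1)] Ck_on_has_derivative[OF Suc.prems(2)]]])
    show "Ck_on n P (\<lambda>p. f p * frechet_derivative g (at p) v + frechet_derivative f (at p) v * g p)" for v
      using Suc.prems Suc.prems[THEN Ck_on_SucD] by (intro Ck_on_add Suc.IH assms(1)) simp_all
  qed
qed

lemma Ck_on_inverse:
  assumes "open P" "Ck_on n P f" "\<And>p. p \<in> P \<Longrightarrow> f p \<noteq> 0"
  shows "Ck_on n P (\<lambda>p. inverse (f p))"
  using assms(2,3)
proof (induction n arbitrary: f)
  case 0
  then show ?case by (simp add: continuous_on_inverse)
next
  case (Suc n)
  show ?case
  proof (rule Ck_on_SucI[OF assms(1)
          Deriv.has_derivative_inverse[OF Suc.prems(2) Ck_on_has_derivative[OF Suc.prems(1)]]])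
    have "Ck_on n P (\<lambda>p. inverse (f p))"
      using Suc.prems(1)[THEN Ck_on_SucD] Suc.prems(2) by (rule Suc.IH)
    then have "Ck_on n P (\<lambda>p. (- 1) * (inverse (f p) * frechet_derivative f (at p) v * inverse (f p)))" for v
      using Suc.prems by (intro Ck_on_mult Ck_on_const assms(1)) simp_all
    then show "Ck_on n P (\<lambda>p. - (inverse (f p) * frechet_derivative f (at p) v * inverse (f p)))" for v
      by simp
  qed
qed

lemma smooth_on_const: "open P \<Longrightarrow> smooth_on P (\<lambda>_. c)"
  by (simp add: smooth_on_def Ck_on_const)

lemma smooth_on_bounded_linear: "open P \<Longrightarrow> bounded_linear f \<Longrightarrow> smooth_on P f"
  by (simp add: smooth_on_def Ck_on_bounded_linear)

lemma smooth_on_cong: "open P \<Longrightarrow> smooth_on P f \<Longrightarrow> (\<And>p. p \<in> P \<Longrightarrow> f p = g p) \<Longrightarrow> smooth_on P g"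
  unfolding smooth_on_def using Ck_on_cong by blast

lemma smooth_on_add: "open P \<Longrightarrow> smooth_on P f \<Longrightarrow> smooth_on P g \<Longrightarrow> smooth_on P (\<lambda>p. f p + g p)"
  by (simp add: smooth_on_def Ck_on_add)

lemma smooth_on_mult: "open P \<Longrightarrow> smooth_on P f \<Longrightarrow> smooth_on P g \<Longrightarrow> smooth_on P (\<lambda>p. f p * g p)"
  by (simp add: smooth_on_def Ck_on_mult)

lemma smooth_on_divide:
  "open P \<Longrightarrow> smooth_on P f \<Longrightarrow> smooth_on P g \<Longrightarrow> (\<And>p. p \<in> P \<Longrightarrow> g p \<noteq> 0) \<Longrightarrow> smooth_on P (\<lambda>p. f p / g p)"
  by (simp add: smooth_on_def divide_inverse Ck_on_mult Ck_on_inverse)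

lemma smooth_on_sum:
  "open P \<Longrightarrow> (\<And>i. i \<in> I \<Longrightarrow> smooth_on P (f i)) \<Longrightarrow> smooth_on P (\<lambda>p. \<Sum>i\<in>I. f i p)"
  by (induction I rule: infinite_finite_induct) (simp_all add: smooth_on_const smooth_on_add)

lemma smooth_on_prod:
  "open P \<Longrightarrow> (\<And>i. i \<in> I \<Longrightarrow> smooth_on P (f i)) \<Longrightarrow> smooth_on P (\<lambda>p. \<Prod>i\<in>I. f i p)"
  by (induction I rule: infinite_finite_induct) (simp_all add: smooth_on_const smooth_on_mult)

lemma smooth_on_imp_differentiable: "smooth_on P f \<Longrightarrow> p \<in> P \<Longrightarrow> f differentiable (at p)"
  unfolding smooth_on_def by (metis Ck_on.simps(2))


section \<open>Matrix calculus\<close>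

lemma matrix_inv_mult:
  assumes "invertible (A :: real^'n^'n)"
  shows "matrix_inv A ** A = mat 1" "A ** matrix_inv A = mat 1"
  using assms unfolding invertible_def matrix_inv_def by (metis (mono_tags, lifting) someI_ex)+

lemma matrix_inv_unique:
  fixes A B :: "real^'n^'n"
  assumes "A ** B = mat 1"
  shows "matrix_inv A = B"
proof -
  have "invertible A" using assms matrix_left_right_inverse invertible_def by blast
  then show ?thesis
    using assms by (metis matrix_inv_mult(1) matrix_mul_assoc matrix_mul_lid matrix_mul_rid)
qed

lemma transpose_matrix_inv:
  fixes A :: "real^'n^'n"
  assumes "invertible A"
  shows "transpose (matrix_inv A) = matrix_inv (transpose A)"
  by (rule matrix_inv_unique[symmetric])
    (simp add: matrix_inv_mult[OF assms] flip: matrix_transpose_mul)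

lemma matrix_inv_entry:
  fixes A :: "real^'n^'n"
  assumes "det A \<noteq> 0"
  shows "matrix_inv A $ k $ l = det (\<chi> i j. if j = k then mat 1 $ i $ l else A $ i $ j) / det A"
proof -
  have "A *v column l (matrix_inv A) = column l (mat 1)"
    using matrix_inv_mult(2)[of A] assms
    by (simp add: invertible_det_nz vec_eq_iff column_def matrix_vector_mult_def matrix_matrix_mult_def)
  then have "column l (matrix_inv A) $ k
      = det (\<chi> i j. if j = k then column l (mat 1) $ i else A $ i $ j) / det A"
    by (subst (asm) cramer[OF assms]) simp
  then show ?thesis by (simp add: column_def cong: if_cong)
qed

lemma smooth_on_det:
  assumes "open P" "\<And>i j. smooth_on P (\<lambda>p. A p $ i $ j)"
  shows "smooth_on P (\<lambda>p. det (A p))"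
  unfolding det_def
  by (intro smooth_on_sum smooth_on_mult smooth_on_prod smooth_on_const assms)

lemma smooth_on_matrix_mult:
  assumes "open P" "\<And>i j. smooth_on P (\<lambda>p. A p $ i $ j)" "\<And>i j. smooth_on P (\<lambda>p. B p $ i $ j)"
  shows "smooth_on P (\<lambda>p. (A p ** B p) $ i $ j)"
  unfolding matrix_matrix_mult_def
  by (simp add: smooth_on_sum smooth_on_mult assms)

lemma smooth_on_matrix_inv:
  fixes A :: "'p::euclidean_space \<Rightarrow> real^'n^'n"
  assumes "open P" "\<And>i j. smooth_on P (\<lambda>p. A p $ i $ j)" "\<And>p. p \<in> P \<Longrightarrow> det (A p) \<noteq> 0"
  shows "smooth_on P (\<lambda>p. matrix_inv (A p) $ i $ j)"
proof (rule smooth_on_cong[OF assms(1)])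
  show "smooth_on P (\<lambda>p. det (\<chi> k l. if l = i then mat 1 $ k $ j else A p $ k $ l) / det (A p))"
  proof (intro smooth_on_divide smooth_on_det assms)
    show "smooth_on P (\<lambda>p. (\<chi> k l. if l = i then mat 1 $ k $ j else A p $ k $ l) $ k $ l)" for k l
      by (cases "l = i") (simp_all add: smooth_on_const assms)
  qed
qed (simp add: matrix_inv_entry assms(3))

lemma bounded_bilinear_matrix_mult:
  "bounded_bilinear (\<lambda>(A :: real^'m^'n) (B :: real^'k^'m). A ** B)"
  unfolding bilinear_conv_bounded_bilinear[symmetric] bilinear_def
  by (intro conjI allI linearI)
    (simp_all add: matrix_matrix_mult_def vec_eq_iff distrib_left distrib_right sum.distrib sum_distrib_left mult_ac)

lemmas matrix_mult_add_left = bounded_bilinear.add_left[OF bounded_bilinear_matrix_mult]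
lemmas matrix_mult_minus_left = bounded_bilinear.minus_left[OF bounded_bilinear_matrix_mult]
lemmas matrix_mult_minus_right = bounded_bilinear.minus_right[OF bounded_bilinear_matrix_mult]
lemmas matrix_mult_scaleR_left = bounded_bilinear.scaleR_left[OF bounded_bilinear_matrix_mult]
lemmas matrix_mult_scaleR_right = bounded_bilinear.scaleR_right[OF bounded_bilinear_matrix_mult]

lemma inner_Basis_matrix:
  assumes "b \<in> (Basis :: (real^'n^'m) set)"
  obtains i j where "\<And>A. inner A b = A $ i $ j"
proof -
  from assms obtain i j where "b = axis i (axis j 1)"
    by (auto simp: Basis_vec_def)
  then have "inner A b = A $ i $ j" for A by (simp add: inner_axis)
  then show ?thesis by (rule that)
qed

lemma differentiable_matrix:
  fixes f :: "'p::real_normed_vector \<Rightarrow> real^'n^'m"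
  assumes "\<And>i j. (\<lambda>x. f x $ i $ j) differentiable (at a)"
  shows "f differentiable (at a)"
  unfolding differentiable_componentwise_within[of f]
proof
  fix b :: "real^'n^'m" assume "b \<in> Basis"
  then obtain i j where "\<And>A. inner A b = A $ i $ j" by (rule inner_Basis_matrix) blast
  then show "(\<lambda>x. inner (f x) b) differentiable (at a)"
    using assms by simp
qed

lemma has_vector_derivative_matrix:
  fixes f :: "real \<Rightarrow> real^'n^'m"
  assumes "\<And>i j. ((\<lambda>t. f t $ i $ j) has_real_derivative D $ i $ j) (at a)"
  shows "(f has_vector_derivative D) (at a)"
  unfolding has_vector_derivative_def has_derivative_componentwise_within[of f]
proof
  fix b :: "real^'n^'m" assume "b \<in> Basis"
  then obtain i j where "\<And>A. inner A b = A $ i $ j" by (rule inner_Basis_matrix) blast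
  then show "((\<lambda>x. inner (f x) b) has_derivative (\<lambda>x. inner (x *\<^sub>R D) b)) (at a)"
    using assms[of i j] by (simp add: has_field_derivative_def mult.commute[of "D $ i $ j"] mult_commute_abs)
qed

lemma has_derivative_matrix_inv:
  fixes A :: "real^'n^'n"
  assumes "invertible A"
  shows "(matrix_inv has_derivative (\<lambda>V. - (matrix_inv A ** V ** matrix_inv A))) (at A)"
proof -
  let ?P = "{X :: real^'n^'n. det X \<noteq> 0}"
  have entry: "smooth_on S (\<lambda>X :: real^'n^'n. X $ i $ j)" if "open S" for S i j
    using that
    by (intro smooth_on_bounded_linear bounded_linear_compose[OF bounded_linear_vec_nth bounded_linear_vec_nth])
  have "continuous_on UNIV (det :: real^'n^'n \<Rightarrow> real)"
    unfolding det_def by (intro continuous_intros)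
  then have P: "open ?P"
    using open_vimage[of "- {0::real}" det] by (simp add: vimage_def open_Compl)
  have A: "A \<in> ?P" using assms by (simp add: invertible_det_nz)
  have "smooth_on ?P (\<lambda>X. matrix_inv X $ i $ j)" for i j
    by (rule smooth_on_matrix_inv[OF P entry[OF P]]) simp
  then have "(matrix_inv :: real^'n^'n \<Rightarrow> _) differentiable (at A)"
    using A by (intro differentiable_matrix) (rule smooth_on_imp_differentiable)
  then obtain D where D: "(matrix_inv has_derivative D) (at A)" unfolding differentiable_def by blast
  \<comment> \<open>differentiate the identity \<open>X ** matrix_inv X = mat 1\<close>\<close>
  have "((\<lambda>X. X ** matrix_inv X) has_derivative (\<lambda>V. A ** D V + V ** matrix_inv A)) (at A)"
    by (rule bounded_bilinear.FDERIV[OF bounded_bilinear_matrix_mult has_derivative_ident D])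
  moreover have "((\<lambda>X. X ** matrix_inv X) has_derivative (\<lambda>V. 0)) (at A)"
    by (rule has_derivative_transform_within_open[OF has_derivative_const[of "mat 1"] P A])
      (simp add: matrix_inv_mult invertible_det_nz)
  ultimately have "(\<lambda>V. A ** D V + V ** matrix_inv A) = (\<lambda>V. 0)"
    by (rule has_derivative_unique)
  then have AD: "A ** D V = - (V ** matrix_inv A)" for V
    by (simp add: eq_neg_iff_add_eq_0 fun_eq_iff)
  have "D V = matrix_inv A ** (A ** D V)" for V
    by (simp add: matrix_mul_assoc matrix_inv_mult(1)[OF assms])
  then have "D = (\<lambda>V. - (matrix_inv A ** V ** matrix_inv A))"
    by (simp add: AD matrix_mult_minus_right matrix_mul_assoc fun_eq_iff)
  then show ?thesis using D by simp
qed

lemma mat_exp_has_vector_derivative: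
  fixes \<xi> :: "real^'n^'n"
  shows "((\<lambda>t. mat_exp (t *\<^sub>R \<xi>)) has_vector_derivative \<xi>) (at 0)"
proof -
  define X where "X i = ((**) \<xi> ^^ i) (mat 1)" for i
  have pow: "((**) (t *\<^sub>R \<xi>) ^^ i) (mat 1) = t ^ i *\<^sub>R X i" for t i
    by (induction i) (simp_all add: X_def matrix_mult_scaleR_left matrix_mult_scaleR_right)
  obtain C where C: "C > 0" "\<And>(A :: real^'n^'n) (B :: real^'n^'n). norm (A ** B) \<le> norm A * norm B * C"
    using bounded_bilinear.pos_bounded[OF bounded_bilinear_matrix_mult] by blast
  let ?N = "norm (mat 1 :: real^'n^'n)"
  have norm_X: "norm (X i) \<le> (C * norm \<xi>) ^ i * ?N" for i
  proof (induction i)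
    case 0
    then show ?case by (simp add: X_def)
  next
    case (Suc i)
    have "norm (X (Suc i)) \<le> norm \<xi> * norm (X i) * C"
      using C(2)[of \<xi> "X i"] by (simp add: X_def)
    also have "\<dots> \<le> norm \<xi> * ((C * norm \<xi>) ^ i * ?N) * C"
      using Suc C(1) by (intro mult_left_mono mult_right_mono) auto
    finally show ?case by (simp add: mult_ac)
  qed
  have summ: "summable (\<lambda>i. (t ^ i / fact i) *\<^sub>R X i)" for t :: real
  proof (rule summable_comparison_test')
    show "summable (\<lambda>i. inverse (fact i) * (\<bar>t\<bar> * (C * norm \<xi>)) ^ i * ?N)"
      by (intro summable_mult2 summable_exp)
    show "norm ((t ^ i / fact i) *\<^sub>R X i) \<le> inverse (fact i) * (\<bar>t\<bar> * (C * norm \<xi>)) ^ i * ?N" for i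
      using mult_left_mono[OF norm_X[of i], of "inverse (fact i) * \<bar>t\<bar> ^ i"]
      by (simp add: power_abs abs_mult power_mult_distrib divide_inverse mult_ac del: mult_le_cancel_left_pos)
  qed
  have exp: "mat_exp (t *\<^sub>R \<xi>) = (\<Sum>i. (t ^ i / fact i) *\<^sub>R X i)" for t
    unfolding mat_exp_def pow by (simp add: divide_inverse mult.commute)
  show ?thesis
  proof (rule has_vector_derivative_matrix)
    fix a b
    let ?c = "\<lambda>i. X i $ a $ b / fact i"
    have bl: "bounded_linear (\<lambda>A :: real^'n^'n. A $ a $ b)"
      by (rule bounded_linear_compose[OF bounded_linear_vec_nth bounded_linear_vec_nth])
    have "mat_exp (t *\<^sub>R \<xi>) $ a $ b = (\<Sum>i. ?c i * t ^ i)" for t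
      unfolding exp using bounded_linear.suminf[OF bl summ, symmetric, of t] by (simp add: mult_ac)
    moreover have "summable (\<lambda>i. ?c i * t ^ i)" for t
      using bounded_linear.summable[OF bl summ[of t]] by (simp add: mult_ac)
    then have "((\<lambda>t. \<Sum>i. ?c i * t ^ i) has_real_derivative (\<Sum>i. diffs ?c i * 0 ^ i)) (at 0)"
      by (rule termdiffs_strong_converges_everywhere)
    moreover have "(\<Sum>i. diffs ?c i * 0 ^ i) = \<xi> $ a $ b"
      unfolding powser_zero by (simp add: diffs_def X_def)
    ultimately show "((\<lambda>t. mat_exp (t *\<^sub>R \<xi>) $ a $ b) has_real_derivative \<xi> $ a $ b) (at 0)"
      by simp
  qed
qed

lemma mat_exp_0: "mat_exp (0 :: real^'n^'n) = mat 1"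
proof -
  have "((**) (0 :: real^'n^'n) ^^ i) (mat 1) /\<^sub>R fact i = 0" if "i \<noteq> 0" for i
    using that by (cases i) (simp_all add: matrix_matrix_mult_def vec_eq_iff)
  then have "mat_exp (0 :: real^'n^'n) = (\<Sum>i\<in>{0}. ((**) (0 :: real^'n^'n) ^^ i) (mat 1) /\<^sub>R fact i)"
    unfolding mat_exp_def by (intro suminf_finite) auto
  then show ?thesis by simp
qed

lemma transpose_minus: "transpose (- A :: real^'n^'m) = - transpose A"
  by (simp add: transpose_def vec_eq_iff)

lemma trace_transpose: "trace (transpose A) = trace (A :: real^'n^'n)"
  by (simp add: trace_def transpose_def)

lemma linear_trace: "linear (trace :: real^'n^'n \<Rightarrow> real)"
  by (intro linearI) (simp_all add: trace_add, simp add: trace_def sum_distrib_left)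

lemma trace_matrix_mult_eq_inner:
  "trace (D ** X) = inner (transpose D) (X :: real^'n^'d)"
  unfolding trace_def matrix_matrix_mult_def inner_vec_def transpose_def
  by (simp, rule sum.swap)

section \<open>The momentum map\<close>

lemma partial_K_unique:
  assumes "\<And>\<delta>. frechet_derivative f (at p) (\<delta>, 0) = trace (D ** \<delta>)"
  shows "partial_K f p = D"
  unfolding partial_K_def
proof (rule the_equality)
  show "\<forall>\<delta>K. frechet_derivative f (at p) (\<delta>K, 0) = trace (D ** \<delta>K)" using assms by blast
next
  fix E assume "\<forall>\<delta>K. frechet_derivative f (at p) (\<delta>K, 0) = trace (E ** \<delta>K)"
  then have "inner (transpose E - transpose D) \<delta> = 0" for \<delta>
    by (simp add: assms trace_matrix_mult_eq_inner inner_diff_left)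
  then have "transpose E = transpose D"
    by (metis inner_eq_zero_iff right_minus_eq)
  then show "E = D" by simp
qed

lemma partial_K_works:
  assumes "f differentiable (at p)"
  shows "frechet_derivative f (at p) (\<delta>, 0) = trace (partial_K f p ** \<delta>)"
proof -
  let ?L = "\<lambda>\<delta>. frechet_derivative f (at p) (\<delta>, 0)"
  have "linear (frechet_derivative f (at p))"
    using assms by (rule linear_frechet_derivative)
  moreover have "linear (\<lambda>\<delta>. (\<delta>, 0))" by (rule linearI) simp_all
  ultimately have "linear ?L"
    using linear_compose[of "\<lambda>\<delta>. (\<delta>, 0)" "frechet_derivative f (at p)"] by (simp add: o_def)
  then have "?L \<delta> = trace (transpose (adjoint ?L 1) ** \<delta>)" for \<delta>
    using adjoint_works[of ?L \<delta> 1] by (simp add: trace_matrix_mult_eq_inner inner_commute)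
  then show ?thesis using partial_K_unique by metis
qed

lemma inf_generator_Sp_act: "inf_generator Sp_act \<xi> (K, M) = (- (K ** \<xi>), 0)"
proof -
  have "(matrix_inv has_derivative (\<lambda>V. - (matrix_inv (mat 1) ** V ** matrix_inv (mat 1))))
      (at (mat_exp (0 *\<^sub>R \<xi>)))"
    using has_derivative_matrix_inv[of "mat 1"] by (simp add: mat_exp_0 invertible_det_nz)
  from has_derivative_compose[OF mat_exp_has_vector_derivative[unfolded has_vector_derivative_def] this]
  have "((\<lambda>t. matrix_inv (mat_exp (t *\<^sub>R \<xi>))) has_derivative
      (\<lambda>t. - (matrix_inv (mat 1) ** (t *\<^sub>R \<xi>) ** matrix_inv (mat 1)))) (at 0)" .
  moreover have "matrix_inv (mat 1) = (mat 1 :: real^'a^'a)"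
    by (rule matrix_inv_unique) simp
  ultimately have "((\<lambda>t. matrix_inv (mat_exp (t *\<^sub>R \<xi>))) has_vector_derivative - \<xi>) (at 0)"
    by (simp add: has_vector_derivative_def)
  then have "((\<lambda>t. K ** matrix_inv (mat_exp (t *\<^sub>R \<xi>))) has_vector_derivative K ** (- \<xi>)) (at 0)"
    by (rule bounded_linear.has_vector_derivative
        [OF bounded_bilinear.bounded_linear_right[OF bounded_bilinear_matrix_mult]])
  then have "((\<lambda>t. Sp_act (mat_exp (t *\<^sub>R \<xi>)) (K, M)) has_vector_derivative (- (K ** \<xi>), 0)) (at 0)"
    unfolding Sp_act_def
    by (simp add: has_vector_derivative_Pair matrix_mult_minus_right)
  then show ?thesis
    unfolding inf_generator_def by (rule vector_derivative_at)
qed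

lemma smooth_on_J_heis:
  "smooth_on (heis_dual_reg :: ('n::finite, 'd::finite) heis_dual set)
     (\<lambda>p. trace_pairing (J_heis J p) \<xi>)"
proof -
  let ?P = "heis_dual_reg :: ('n, 'd) heis_dual set"
  have K: "smooth_on ?P (\<lambda>p. fst p $ i $ j)" for i j
    by (intro smooth_on_bounded_linear open_heis_dual_reg
        bounded_linear_compose[OF bounded_linear_vec_nth]
        bounded_linear_compose[OF bounded_linear_vec_nth bounded_linear_fst])
  have M: "smooth_on ?P (\<lambda>p. mat_of (snd p) $ i $ j)" for i j
    by (intro smooth_on_bounded_linear open_heis_dual_reg
        bounded_linear_compose[OF bounded_linear_vec_nth]
        bounded_linear_compose[OF bounded_linear_mat_of bounded_linear_snd])
  have KT: "smooth_on ?P (\<lambda>p. transpose (fst p) $ i $ j)" for i j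
    using K by (simp add: transpose_def)
  have N: "smooth_on ?P (\<lambda>p. matrix_inv (mat_of (snd p)) $ i $ j)" for i j
    by (rule smooth_on_matrix_inv[OF open_heis_dual_reg M]) (auto simp: heis_dual_reg_def)
  have "smooth_on ?P (\<lambda>p. (matrix_inv J ** transpose (fst p) ** matrix_inv (mat_of (snd p)) ** fst p) $ i $ j)"
    for i j
    by (intro smooth_on_matrix_mult smooth_on_const open_heis_dual_reg K KT N)
  then have "smooth_on ?P (\<lambda>p. - (1/2) * (matrix_inv J ** transpose (fst p) ** matrix_inv (mat_of (snd p)) ** fst p) $ i $ j)"
    for i j
    by (intro smooth_on_mult smooth_on_const open_heis_dual_reg)
  then have "smooth_on ?P (\<lambda>p. J_heis J p $ i $ j)" for i j
    by (simp add: J_heis_def case_prod_unfold)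
  then show ?thesis
    unfolding trace_pairing_def trace_def
    by (intro smooth_on_sum smooth_on_matrix_mult smooth_on_const open_heis_dual_reg)
qed

lemma transpose_matrix_inv_mat_of:
  assumes "det (mat_of M) \<noteq> 0"
  shows "transpose (matrix_inv (mat_of M)) = matrix_inv (mat_of M)"
  using assms by (simp add: transpose_matrix_inv invertible_det_nz)

lemma J_heis_equivariant:
  assumes "invertible J" "g \<in> Sp J"
  shows "J_heis J (Sp_act g p) = coadjoint g (J_heis J p)"
proof -
  obtain K M where p: "p = (K, M)" by fastforce
  let ?h = "matrix_inv g"
  have g: "transpose g ** J ** g = J" using assms(2) by (simp add: Sp_def)
  have inv_g: "invertible g" using invertible_Sp[OF assms] .
  then have inv_gT: "invertible (transpose g)" by (simp add: invertible_det_nz)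
  have "J ** g = transpose ?h ** J"
    using arg_cong[OF g, of "(**) (transpose ?h)"]
    by (simp add: transpose_matrix_inv[OF inv_g] matrix_mul_assoc matrix_inv_mult[OF inv_gT])
  then have "matrix_inv J ** (J ** g) ** matrix_inv J = matrix_inv J ** (transpose ?h ** J) ** matrix_inv J"
    by simp
  then have gJ: "g ** matrix_inv J = matrix_inv J ** transpose ?h"
    by (simp add: matrix_mul_assoc matrix_inv_mult[OF assms(1)])
      (simp add: matrix_inv_mult[OF assms(1)] flip: matrix_mul_assoc)
  then show ?thesis
    by (simp add: p J_heis_def Sp_act_def coadjoint_def matrix_transpose_mul
        matrix_mult_scaleR_left matrix_mult_scaleR_right matrix_mult_minus_left matrix_mult_minus_right
        matrix_mul_assoc)
qed

context
  fixes J :: "real^'n^'n"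
  assumes inv_J: "invertible J" and antisym_J: "transpose J = - J"
begin

lemma transpose_inv_J: "transpose (matrix_inv J) = - matrix_inv J"
  unfolding transpose_matrix_inv[OF inv_J] antisym_J
  by (rule matrix_inv_unique)
    (simp add: matrix_mult_minus_left matrix_mult_minus_right matrix_inv_mult[OF inv_J])

lemma sp_mult_inv_J:
  assumes "\<xi> \<in> sp J"
  shows "\<xi> ** matrix_inv J = - (matrix_inv J ** transpose \<xi>)"
proof -
  have "J ** \<xi> = - (transpose \<xi> ** J)"
    using assms by (simp add: sp_def eq_neg_iff_add_eq_0)
  then have "matrix_inv J ** (J ** \<xi>) ** matrix_inv J
      = matrix_inv J ** (- (transpose \<xi> ** J)) ** matrix_inv J"
    by simp
  also have "\<dots> = - (matrix_inv J ** transpose \<xi> ** (J ** matrix_inv J))"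
    by (simp add: matrix_mult_minus_left matrix_mult_minus_right matrix_mul_assoc)
  finally show ?thesis
    by (simp add: matrix_mul_assoc matrix_inv_mult[OF inv_J])
qed

lemma J_heis_in_sp:
  fixes p :: "('n, 'd::finite) heis_dual"
  assumes "p \<in> heis_dual_reg"
  shows "J_heis J p \<in> sp J"
proof -
  obtain K M where p: "p = (K, M)" by fastforce
  have det: "det (mat_of M) \<noteq> 0" using assms by (simp add: p heis_dual_reg_def)
  let ?S = "transpose K ** matrix_inv (mat_of M) ** K"
  have S: "transpose ?S = ?S"
    by (simp add: matrix_transpose_mul transpose_matrix_inv_mat_of[OF det] matrix_mul_assoc)
  have X: "J_heis J p = - (1/2) *\<^sub>R (matrix_inv J ** ?S)"
    by (simp add: p J_heis_def matrix_mul_assoc)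
  have "J ** J_heis J p = - (1/2) *\<^sub>R ?S"
    by (simp add: X matrix_mult_scaleR_right matrix_mult_minus_right matrix_mul_assoc matrix_inv_mult[OF inv_J])
  moreover have "transpose (J_heis J p) = (1/2) *\<^sub>R (?S ** matrix_inv J)"
    unfolding X transpose_minus transpose_scalar matrix_transpose_mul[of "matrix_inv J"] S transpose_inv_J
    by (simp add: matrix_mult_minus_right)
  then have "transpose (J_heis J p) ** J = (1/2) *\<^sub>R ?S"
    by (simp add: matrix_mult_scaleR_left matrix_mult_minus_left matrix_inv_mult[OF inv_J]
        flip: matrix_mul_assoc)
  ultimately show ?thesis by (simp add: sp_def)
qed

lemma partial_K_J_heis:
  fixes K :: "real^'n^'d"
  assumes "\<xi> \<in> sp J" "(K, M) \<in> heis_dual_reg"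
  shows "partial_K (\<lambda>q. trace_pairing (J_heis J q) \<xi>) (K, M)
    = - (\<xi> ** matrix_inv J ** transpose K ** matrix_inv (mat_of M))"
proof (rule partial_K_unique)
  fix \<delta> :: "real^'n^'d"
  let ?q = "\<lambda>q. trace_pairing (J_heis J q) \<xi>" and ?N = "matrix_inv (mat_of M)"
  have det: "det (mat_of M) \<noteq> 0" using assms by (simp add: heis_dual_reg_def)
  have "linear (\<lambda>X :: real^'n^'d. matrix_inv J ** transpose X ** ?N)"
    by (intro linearI)
      (simp_all add: transpose_def matrix_matrix_mult_def vec_eq_iff distrib_left distrib_right
        sum.distrib sum_distrib_left mult_ac)
  then have lin: "((\<lambda>X. matrix_inv J ** transpose X ** ?N) has_derivative
      (\<lambda>X. matrix_inv J ** transpose X ** ?N)) (at K)"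
    by (intro bounded_linear_imp_has_derivative) (simp add: linear_conv_bounded_linear)
  have "linear (\<lambda>X :: real^'n^'n. trace (- (1/2) *\<^sub>R X ** \<xi>))"
    by (intro linearI)
      (simp_all only: scaleR_add_right matrix_mult_add_left trace_add matrix_mult_scaleR_left
        linear_cmul[OF linear_trace] mult.left_commute real_scaleR_def)
  then have blin: "bounded_linear (\<lambda>X :: real^'n^'n. trace (- (1/2) *\<^sub>R X ** \<xi>))"
    by (simp add: linear_conv_bounded_linear)
  have "((\<lambda>X. matrix_inv J ** transpose X ** ?N ** X) has_derivative
     (\<lambda>\<delta>. matrix_inv J ** transpose K ** ?N ** \<delta> + matrix_inv J ** transpose \<delta> ** ?N ** K)) (at K)"
    by (rule bounded_bilinear.FDERIV[OF bounded_bilinear_matrix_mult lin has_derivative_ident])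
  from bounded_linear.has_derivative[OF blin this]
  have 1: "((\<lambda>X. ?q (X, M)) has_derivative
     (\<lambda>\<delta>. trace (- (1/2) *\<^sub>R (matrix_inv J ** transpose K ** ?N ** \<delta>
        + matrix_inv J ** transpose \<delta> ** ?N ** K) ** \<xi>))) (at K)"
    by (simp add: J_heis_def trace_pairing_def)
  have "(?q has_derivative frechet_derivative ?q (at (K, M))) (at (K, M))"
    using smooth_on_imp_differentiable[OF smooth_on_J_heis assms(2)] frechet_derivative_works by blast
  moreover have "((\<lambda>X. (X, M)) has_derivative (\<lambda>\<delta>. (\<delta>, 0))) (at K)"
    by (intro derivative_intros)
  ultimately have "((\<lambda>X. ?q (X, M)) has_derivative
      (\<lambda>\<delta>. frechet_derivative ?q (at (K, M)) (\<delta>, 0))) (at K)"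
    using has_derivative_compose[of "\<lambda>X. (X, M)" _ K UNIV ?q] by blast
  then have "frechet_derivative ?q (at (K, M)) (\<delta>, 0)
      = trace (- (1/2) *\<^sub>R (matrix_inv J ** transpose K ** ?N ** \<delta>
        + matrix_inv J ** transpose \<delta> ** ?N ** K) ** \<xi>)"
    by (rule fun_cong[OF has_derivative_unique[OF _ 1]])
  also have "\<dots> = - (1/2) * (trace (matrix_inv J ** transpose K ** ?N ** \<delta> ** \<xi>)
        + trace (matrix_inv J ** transpose \<delta> ** ?N ** K ** \<xi>))"
    by (simp add: matrix_mult_scaleR_left matrix_mult_minus_left linear_neg[OF linear_trace]
        linear_cmul[OF linear_trace] trace_add matrix_mult_add_left)
  also have "trace (matrix_inv J ** transpose \<delta> ** ?N ** K ** \<xi>)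
      = trace (transpose (matrix_inv J ** transpose \<delta> ** ?N ** K ** \<xi>))"
    by (rule trace_transpose[symmetric])
  also have "\<dots> = trace ((transpose \<xi> ** transpose K ** ?N ** \<delta>) ** (- matrix_inv J))"
    by (simp add: matrix_transpose_mul transpose_inv_J transpose_matrix_inv_mat_of[OF det] matrix_mul_assoc)
  also have "\<dots> = trace (- (matrix_inv J ** transpose \<xi>) ** transpose K ** ?N ** \<delta>)"
    by (subst trace_mul_sym) (simp add: matrix_mult_minus_left matrix_mul_assoc)
  also have "\<dots> = trace (\<xi> ** matrix_inv J ** transpose K ** ?N ** \<delta>)"
    by (simp add: sp_mult_inv_J[OF assms(1)])
  also have "trace (matrix_inv J ** transpose K ** ?N ** \<delta> ** \<xi>)
      = trace (\<xi> ** matrix_inv J ** transpose K ** ?N ** \<delta>)"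
    by (subst trace_mul_sym) (simp add: matrix_mul_assoc)
  finally show "frechet_derivative ?q (at (K, M)) (\<delta>, 0)
      = trace (- (\<xi> ** matrix_inv J ** transpose K ** ?N) ** \<delta>)"
    by (simp add: matrix_mult_minus_left linear_neg[OF linear_trace])
qed

lemma lie_poisson_J_heis:
  fixes K :: "real^'n^'d"
  assumes "\<xi> \<in> sp J" "(K, M) \<in> heis_dual_reg" "f differentiable (at (K, M))"
  shows "lie_poisson J f (\<lambda>q. trace_pairing (J_heis J q) \<xi>) (K, M)
    = frechet_derivative f (at (K, M)) (inf_generator Sp_act \<xi> (K, M))"
proof -
  let ?D = "partial_K f (K, M)" and ?M = "mat_of M"
  have inv_M: "invertible ?M" using assms by (simp add: heis_dual_reg_def invertible_det_nz)
  have J\<xi>: "J ** \<xi> = - (transpose \<xi> ** J)"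
    using assms by (simp add: sp_def eq_neg_iff_add_eq_0)
  have "lie_poisson J f (\<lambda>q. trace_pairing (J_heis J q) \<xi>) (K, M)
      = trace (?M ** (transpose ?D ** J ** \<xi> ** matrix_inv J ** transpose K ** matrix_inv ?M))"
    by (simp add: lie_poisson_def partial_K_J_heis[OF assms(1,2)] matrix_mult_minus_right
        linear_neg[OF linear_trace] matrix_mul_assoc)
  also have "\<dots> = trace (transpose ?D ** (J ** \<xi>) ** matrix_inv J ** transpose K)"
    by (subst trace_mul_sym)
      (simp add: matrix_inv_mult[OF inv_M] flip: matrix_mul_assoc)
  also have "\<dots> = - trace (transpose ?D ** transpose \<xi> ** transpose K)"
    unfolding J\<xi>
    by (simp add: matrix_mult_minus_right matrix_mult_minus_left linear_neg[OF linear_trace])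
      (simp add: matrix_inv_mult[OF inv_J] flip: matrix_mul_assoc)
  also have "transpose ?D ** transpose \<xi> ** transpose K = transpose (K ** \<xi> ** ?D)"
    by (simp add: matrix_transpose_mul matrix_mul_assoc)
  also have "- trace (transpose (K ** \<xi> ** ?D)) = trace (?D ** (- (K ** \<xi>)))"
    unfolding trace_transpose
    by (subst trace_mul_sym) (simp add: matrix_mult_minus_right linear_neg[OF linear_trace])
  finally show ?thesis
    by (simp add: inf_generator_Sp_act partial_K_works[OF assms(3)])
qed

end

theorem proposition2p8:
  fixes J :: "real^'n^'n" and k :: nat
  assumes "CARD('n) = 2 * k"
    and "invertible J"
    and "transpose J = - J"
  shows "momentum_map (heis_dual_reg :: ('n, 'd::finite) heis_dual set)
           (lie_poisson J) (sp J) Sp_act (J_heis J) \<and>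
         equivariant (heis_dual_reg :: ('n, 'd) heis_dual set) (Sp J) Sp_act (J_heis J)"
  unfolding momentum_map_def equivariant_def
proof (intro conjI ballI allI impI)
  fix p :: "('n, 'd) heis_dual" and \<xi> :: "real^'n^'n" and f :: "('n, 'd) heis_dual \<Rightarrow> real"
  assume p: "p \<in> heis_dual_reg"
  then show "J_heis J p \<in> sp J" by (rule J_heis_in_sp[OF assms(2,3)])
  show "J_heis J (Sp_act g p) = coadjoint g (J_heis J p)" if "g \<in> Sp J" for g
    using that by (rule J_heis_equivariant[OF assms(2)])
  assume "\<xi> \<in> sp J" and f: "smooth_on heis_dual_reg f"
  with p show "lie_poisson J f (\<lambda>q. trace_pairing (J_heis J q) \<xi>) p
      = frechet_derivative f (at p) (inf_generator Sp_act \<xi> p)"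
    using lie_poisson_J_heis[OF assms(2,3)] smooth_on_imp_differentiable[OF f p]
    by (cases p) simp
qed (rule smooth_on_J_heis)

end
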